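(* Let $(X,\mathcal{A},\mu)$ be a measure space with $\mu(X)>0$ such that $X$ is not an atom. The following statements are equivalent: (1) $\Gamma(\mathcal{M}(X,\mathcal{A}))=AG(\mathcal{M}(X,\mathcal{A}))$ (the zero-divisor graph equals the annihilator graph); (2) $\Gamma'_2(\mathcal{M}(X,\mathcal{A}))=AG(\mathcal{M}(X,\mathcal{A}))$ (the comaximal graph equals the annihilator graph); (3) $X$ is partitioned into two atoms, i.e. $X=A\sqcup B$ for some atoms $A,B\in\mathcal{A}$.
   Context: $\mathcal{M}(X,\mathcal{A})$ is the commutative ring (pointwise operations) of all $\mathcal{A}$-measurable functions $f:X\to\mathbb{R}$; $Z(f)=\{x\in X:f(x)=0\}$. A set $A\in\mathcal{A}$ is an atom if $\mu(A)>0$ and $A$ cannot be written as a disjoint union $A=B\sqcup C$ with $B,C\in\mathcal{A}$, $\mu(B)>0$, $\mu(C)>0$. A function $u$ is a $\mu$-unit if $\mu(Z(u))=0$. Write $\mathscr{D}=\{f\in\mathcal{M}(X,\mathcal{A}):\mu(Z(f))>0\text{ and }\mu(X\setminus Z(f))>0\}$, and $ann(f)=\{g\in\mathcal{M}(X,\mathcal{A}): fg=0\ \mu\text{-a.e. on }X\}$. All three graphs are simple graphs with vertex set $\mathscr{D}$. Distinct $f,g\in\mathscr{D}$ are adjacent: in the zero-divisor graph $\Gamma$ iff $\mu((X\setminus Z(f))\cap(X\setminus Z(g)))=0$; in the comaximal graph $\Gamma'_2$ iff $\langle f\rangle+\langle g\rangle=\langle u\rangle$ (sum of principal ideals) for some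 $\mu$-unit $u$; in the annihilator graph $AG$ iff $ann(f)\cup ann(g)\subsetneqq ann(fg)$. Equality of graphs means having the same edges. *)

theory Defs
  imports "HOL-Analysis.Analysis" "HOL-Algebra.Ideal"
begin

text \<open>
  The ring of measurable real functions on a measure space. Its elements are functions on
  \<open>space M\<close>, so they are taken extensional: otherwise two functions that agree on \<open>space M\<close>
  could be distinct elements, hence distinct vertices of the graphs below.
\<close>

definition meas_ring :: "'a measure \<Rightarrow> ('a \<Rightarrow> real) ring" where
  "meas_ring M =
     \<lparr>carrier = borel_measurable M \<inter> extensional (space M),
      monoid.mult = (\<lambda>f g. \<lambda>x\<in>space M. f x * g x),
      one = (\<lambda>x\<in>space M. 1),
      zero = (\<lambda>x\<in>space M. 0),
      add = (\<lambda>f g. \<lambda>x\<in>space M. f x + g x)\<rparr>"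

lemma cring_meas_ring: "cring (meas_ring M)"
proof (rule cringI)
  show "abelian_group (meas_ring M)"
  proof (rule abelian_groupI)
    fix f assume f: "f \<in> carrier (meas_ring M)"
    show "\<exists>g\<in>carrier (meas_ring M). g \<oplus>\<^bsub>meas_ring M\<^esub> f = \<zero>\<^bsub>meas_ring M\<^esub>"
      using f by (intro bexI[of _ "\<lambda>x\<in>space M. - f x"])
        (auto simp: meas_ring_def fun_eq_iff restrict_def extensional_def cong: measurable_cong)
  qed (auto simp: meas_ring_def fun_eq_iff restrict_def extensional_def
        cong: measurable_cong)
  show "Group.comm_monoid (meas_ring M)"
    by (rule comm_monoidI) (auto simp: meas_ring_def fun_eq_iff restrict_def extensional_def
        cong: measurable_cong)
qed (auto simp: meas_ring_def fun_eq_iff restrict_def algebra_simps)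

definition zero_set :: "'a measure \<Rightarrow> ('a \<Rightarrow> real) \<Rightarrow> 'a set" where
  "zero_set M f = {x \<in> space M. f x = 0}"

definition is_atom :: "'a measure \<Rightarrow> 'a set \<Rightarrow> bool" where
  "is_atom M A \<longleftrightarrow> A \<in> sets M \<and> emeasure M A > 0 \<and>
     \<not> (\<exists>B\<in>sets M. \<exists>C\<in>sets M. A = B \<union> C \<and> B \<inter> C = {} \<and>
          emeasure M B > 0 \<and> emeasure M C > 0)"

definition mu_unit :: "'a measure \<Rightarrow> ('a \<Rightarrow> real) \<Rightarrow> bool" where
  "mu_unit M u \<longleftrightarrow> u \<in> carrier (meas_ring M) \<and> emeasure M (zero_set M u) = 0"

definition vertex_set :: "'a measure \<Rightarrow> ('a \<Rightarrow> real) set" where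
  "vertex_set M = {f \<in> carrier (meas_ring M).
     emeasure M (zero_set M f) > 0 \<and> emeasure M (space M - zero_set M f) > 0}"

definition ann :: "'a measure \<Rightarrow> ('a \<Rightarrow> real) \<Rightarrow> ('a \<Rightarrow> real) set" where
  "ann M f = {g \<in> carrier (meas_ring M). AE x in M. (f \<otimes>\<^bsub>meas_ring M\<^esub> g) x = 0}"

text \<open>
  A simple graph is a pair of a (possibly infinite) vertex set and a set of two-element sets of
  vertices. All three adjacency relations used below are symmetric.
\<close>

definition simple_graph :: "'v set \<Rightarrow> ('v \<Rightarrow> 'v \<Rightarrow> bool) \<Rightarrow> 'v set \<times> 'v set set" where
  "simple_graph V adj = (V, {{f, g} |f g. f \<in> V \<and> g \<in> V \<and> f \<noteq> g \<and> adj f g})"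

definition zero_divisor_graph ::
    "'a measure \<Rightarrow> ('a \<Rightarrow> real) set \<times> ('a \<Rightarrow> real) set set" where
  "zero_divisor_graph M = simple_graph (vertex_set M)
     (\<lambda>f g. emeasure M ((space M - zero_set M f) \<inter> (space M - zero_set M g)) = 0)"

definition comaximal_graph ::
    "'a measure \<Rightarrow> ('a \<Rightarrow> real) set \<times> ('a \<Rightarrow> real) set set" where
  "comaximal_graph M = simple_graph (vertex_set M)
     (\<lambda>f g. \<exists>u. mu_unit M u \<and>
        (PIdl\<^bsub>meas_ring M\<^esub> f) <+>\<^bsub>meas_ring M\<^esub> (PIdl\<^bsub>meas_ring M\<^esub> g) = PIdl\<^bsub>meas_ring M\<^esub> u)"

definition annihilator_graph ::
    "'a measure \<Rightarrow> ('a \<Rightarrow> real) set \<times> ('a \<Rightarrow> real) set set" where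
  "annihilator_graph M = simple_graph (vertex_set M)
     (\<lambda>f g. ann M f \<union> ann M g \<subset> ann M (f \<otimes>\<^bsub>meas_ring M\<^esub> g))"

end

theory Submission
  imports Defs
begin

text \<open>
  Write \<open>S\<close> and \<open>T\<close> for the cozero sets of \<open>f\<close> and \<open>g\<close>. Adjacency only depends on them: it means
  that \<open>S \<inter> T\<close> is null in the zero-divisor graph, that the complement of \<open>S \<union> T\<close> is null in the
  comaximal graph, and that neither \<open>S - T\<close> nor \<open>T - S\<close> is null in the annihilator graph.
  If the space splits into two atoms, a measurable set is determined up to null sets by the atoms
  it meets, and all three conditions say that \<open>S\<close> and \<open>T\<close> are, up to null sets, the two atoms.
  Otherwise the space splits into three sets \<open>P\<close>, \<open>Q\<close>, \<open>R\<close> of positive measure. Then the indicators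
  of \<open>P \<union> Q\<close> and \<open>Q \<union> R\<close> are adjacent in the annihilator graph but not in the zero-divisor graph,
  and the indicators of \<open>P\<close> and \<open>Q\<close> are adjacent in the annihilator graph but not in the comaximal
  graph.
\<close>

section \<open>Cozero sets, ring operations and positive measure\<close>

definition cozero_set :: "'a measure \<Rightarrow> ('a \<Rightarrow> real) \<Rightarrow> 'a set" where
  "cozero_set M f = space M - zero_set M f"

lemma mem_cozero_set: "x \<in> cozero_set M f \<longleftrightarrow> x \<in> space M \<and> f x \<noteq> 0"
  by (auto simp: cozero_set_def zero_set_def)

lemma zero_set_eq: "zero_set M f = space M - cozero_set M f"
  by (auto simp: cozero_set_def zero_set_def)

lemma carrier_meas_ring_iff:
  "f \<in> carrier (meas_ring M) \<longleftrightarrow> f \<in> borel_measurable M \<and> f \<in> extensional (space M)"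
  by (simp add: meas_ring_def)

lemma mult_meas_ring: "f \<otimes>\<^bsub>meas_ring M\<^esub> g = (\<lambda>x\<in>space M. f x * g x)"
  by (simp add: meas_ring_def)

lemma add_meas_ring: "f \<oplus>\<^bsub>meas_ring M\<^esub> g = (\<lambda>x\<in>space M. f x + g x)"
  by (simp add: meas_ring_def)

lemma restrict_in_carrier_meas_ring:
  assumes "f \<in> borel_measurable M"
  shows "restrict f (space M) \<in> carrier (meas_ring M)"
  using assms by (auto simp: carrier_meas_ring_iff cong: measurable_cong)

lemma sets_cozero_set:
  assumes "f \<in> carrier (meas_ring M)"
  shows "cozero_set M f \<in> sets M"
proof -
  have [measurable]: "f \<in> borel_measurable M"
    using assms by (simp add: carrier_meas_ring_iff)
  have "{x \<in> space M. f x \<noteq> 0} \<in> sets M"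
    by measurable
  also have "{x \<in> space M. f x \<noteq> 0} = cozero_set M f"
    by (auto simp: mem_cozero_set)
  finally show ?thesis .
qed

lemma vertex_set_carrier: "f \<in> vertex_set M \<Longrightarrow> f \<in> carrier (meas_ring M)"
  by (simp add: vertex_set_def)

lemma vertex_set_iff:
  "f \<in> vertex_set M \<longleftrightarrow> f \<in> carrier (meas_ring M) \<and>
     0 < emeasure M (cozero_set M f) \<and> 0 < emeasure M (space M - cozero_set M f)"
  using zero_set_eq[of M f] by (auto simp: vertex_set_def cozero_set_def[symmetric])

lemma emeasure_pos_mono:
  assumes "S \<subseteq> T" "T \<in> sets M" "0 < emeasure M S"
  shows "0 < emeasure M T"
  using emeasure_mono[OF assms(1,2)] assms(3) by (rule less_le_trans[rotated])

text \<open>Null sets are closed under unions and measurable subsets. Here and below nullness is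
  expressed through positivity, so that adjacency becomes a Boolean condition on statements
  \<open>0 < emeasure M _\<close>.\<close>

lemma emeasure_Un_pos_iff:
  assumes "S \<in> sets M" "T \<in> sets M"
  shows "0 < emeasure M (S \<union> T) \<longleftrightarrow> 0 < emeasure M S \<or> 0 < emeasure M T"
proof -
  have "emeasure M (S \<union> T) = 0 \<longleftrightarrow> emeasure M S = 0 \<and> emeasure M T = 0"
    using assms emeasure_Un_null_set[of S M T] emeasure_pos_mono[of S "S \<union> T" M]
      emeasure_pos_mono[of T "S \<union> T" M]
    by (auto simp: null_sets_def zero_less_iff_neq_zero)
  then show ?thesis
    by (auto simp: zero_less_iff_neq_zero)
qed

text \<open>An edge \<open>{f, g}\<close> forgets the order of its ends; symmetry is what lets
  \<open>a f g\<close> be read back from it. It is required on \<open>V\<close> only, because the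
  criteria that yield symmetry below hold for ring elements.\<close>

lemma simple_graph_eq_iff:
  assumes "\<And>f g. f \<in> V \<Longrightarrow> g \<in> V \<Longrightarrow> a f g \<longleftrightarrow> a g f" "\<And>f g. f \<in> V \<Longrightarrow> g \<in> V \<Longrightarrow> b f g \<longleftrightarrow> b g f"
  shows "simple_graph V a = simple_graph V b \<longleftrightarrow>
    (\<forall>f\<in>V. \<forall>g\<in>V. f \<noteq> g \<longrightarrow> (a f g \<longleftrightarrow> b f g))" (is "?eq \<longleftrightarrow> ?all")
proof -
  have edge: "{f, g} \<in> snd (simple_graph V c) \<longleftrightarrow> c f g"
    if "f \<in> V" "g \<in> V" "f \<noteq> g" "\<And>f g. f \<in> V \<Longrightarrow> g \<in> V \<Longrightarrow> c f g \<longleftrightarrow> c g f" for c f g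
    using that by (auto simp: simple_graph_def doubleton_eq_iff)
  show ?thesis
  proof
    assume ?eq
    then show ?all
      using edge[of _ _ a] edge[of _ _ b] assms by metis
  next
    assume ?all
    then show ?eq
      unfolding simple_graph_def by (intro arg_cong[where f = "Pair V"] Collect_cong) metis
  qed
qed

section \<open>Annihilators in terms of cozero sets\<close>

lemma mem_ann_iff:
  assumes "f \<in> carrier (meas_ring M)"
  shows "h \<in> ann M f \<longleftrightarrow>
    h \<in> carrier (meas_ring M) \<and> \<not> 0 < emeasure M (cozero_set M f \<inter> cozero_set M h)"
proof (cases "h \<in> carrier (meas_ring M)")
  case True
  \<comment> \<open>The product is nonzero exactly on the intersection of the two cozero sets, which
    is measurable.\<close>
  have "(AE x in M. (f \<otimes>\<^bsub>meas_ring M\<^esub> h) x = 0) \<longleftrightarrow>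
      emeasure M (cozero_set M f \<inter> cozero_set M h) = 0"
    using assms True
    by (intro AE_iff_measurable sets.Int sets_cozero_set)
       (auto simp: mem_cozero_set mult_meas_ring)
  then show ?thesis
    using True by (simp add: ann_def)
qed (simp add: ann_def)

lemma cozero_set_mult: "cozero_set M (f \<otimes>\<^bsub>meas_ring M\<^esub> g) = cozero_set M f \<inter> cozero_set M g"
  by (auto simp: mem_cozero_set mult_meas_ring)

lemma mult_closed_meas_ring:
  assumes "f \<in> carrier (meas_ring M)" "g \<in> carrier (meas_ring M)"
  shows "f \<otimes>\<^bsub>meas_ring M\<^esub> g \<in> carrier (meas_ring M)"
  using assms cring_meas_ring[of M] by (simp add: cring.cring_simprules)

text \<open>Realises any measurable set as a cozero set; the restriction provides the extensionality
  demanded by the carrier.\<close>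

definition ind_fun :: "'a measure \<Rightarrow> 'a set \<Rightarrow> 'a \<Rightarrow> real" where
  "ind_fun M S = restrict (indicator S) (space M)"

lemma ind_fun_in_carrier: "S \<in> sets M \<Longrightarrow> ind_fun M S \<in> carrier (meas_ring M)"
  unfolding ind_fun_def by (intro restrict_in_carrier_meas_ring borel_measurable_indicator)

lemma cozero_set_ind_fun:
  assumes "S \<in> sets M"
  shows "cozero_set M (ind_fun M S) = S"
  using sets.sets_into_space[OF assms]
  by (auto simp: mem_cozero_set ind_fun_def indicator_def split: if_splits)

text \<open>A function separates the two sides iff its cozero set meets \<open>?S\<close> and
  \<open>?T\<close> in positive measure but \<open>?S \<inter> ?T\<close> only in a null set. Such a
  set must charge both differences; conversely the symmetric difference is such a set whenever both
  differences are positive.\<close>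

lemma ann_Un_psubset_iff:
  assumes f: "f \<in> carrier (meas_ring M)" and g: "g \<in> carrier (meas_ring M)"
  shows "ann M f \<union> ann M g \<subset> ann M (f \<otimes>\<^bsub>meas_ring M\<^esub> g) \<longleftrightarrow>
    0 < emeasure M (cozero_set M f - cozero_set M g) \<and>
    0 < emeasure M (cozero_set M g - cozero_set M f)" (is "?psub \<longleftrightarrow> ?pos")
proof -
  let ?S = "cozero_set M f" and ?T = "cozero_set M g"
  note [measurable] = sets_cozero_set[OF f] sets_cozero_set[OF g]
  note fg = mult_closed_meas_ring[OF f g]
  note ann_iff = mem_ann_iff[OF f] mem_ann_iff[OF g] mem_ann_iff[OF fg] cozero_set_mult
  have sub: "ann M f \<union> ann M g \<subseteq> ann M (f \<otimes>\<^bsub>meas_ring M\<^esub> g)"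
  proof
    fix h assume "h \<in> ann M f \<union> ann M g"
    then have "h \<in> carrier (meas_ring M)"
      and *: "\<not> 0 < emeasure M (?S \<inter> cozero_set M h) \<or> \<not> 0 < emeasure M (?T \<inter> cozero_set M h)"
      by (auto simp: ann_iff)
    then have [measurable]: "cozero_set M h \<in> sets M"
      by (intro sets_cozero_set)
    have "\<not> 0 < emeasure M (?S \<inter> ?T \<inter> cozero_set M h)"
      using * emeasure_pos_mono[of "?S \<inter> ?T \<inter> cozero_set M h" "?S \<inter> cozero_set M h" M]
        emeasure_pos_mono[of "?S \<inter> ?T \<inter> cozero_set M h" "?T \<inter> cozero_set M h" M]
      by (auto simp del: not_gr_zero)
    then show "h \<in> ann M (f \<otimes>\<^bsub>meas_ring M\<^esub> g)"
      using \<open>h \<in> carrier (meas_ring M)\<close> by (simp add: ann_iff)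
  qed
  show ?thesis
  proof
    assume ?psub
    then obtain h where "h \<in> ann M (f \<otimes>\<^bsub>meas_ring M\<^esub> g)" "h \<notin> ann M f" "h \<notin> ann M g"
      by blast
    then have h: "h \<in> carrier (meas_ring M)"
      and pos: "0 < emeasure M (?S \<inter> cozero_set M h)" "0 < emeasure M (?T \<inter> cozero_set M h)"
      and null: "\<not> 0 < emeasure M (?S \<inter> ?T \<inter> cozero_set M h)"
      unfolding ann_iff by blast+
    let ?H = "cozero_set M h"
    note [measurable] = sets_cozero_set[OF h]
    \<comment> \<open>\<open>?S \<inter> ?H\<close> lies in this union, whose second part is null,
      so \<open>?S - ?T\<close> has positive measure. The next step is the mirror image.\<close>
    have "0 < emeasure M ((?S - ?T) \<union> (?S \<inter> ?T \<inter> ?H))"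
      by (rule emeasure_pos_mono[OF _ _ pos(1)]) auto
    moreover have "0 < emeasure M ((?T - ?S) \<union> (?S \<inter> ?T \<inter> ?H))"
      by (rule emeasure_pos_mono[OF _ _ pos(2)]) auto
    ultimately show ?pos
      using null by (auto simp: emeasure_Un_pos_iff)
  next
    assume ?pos
    let ?D = "(?S - ?T) \<union> (?T - ?S)"
    have "?S \<inter> ?D = ?S - ?T" "?T \<inter> ?D = ?T - ?S" "?S \<inter> ?T \<inter> ?D = {}"
      by auto
    then have "ind_fun M ?D \<in> ann M (f \<otimes>\<^bsub>meas_ring M\<^esub> g) - (ann M f \<union> ann M g)"
      using \<open>?pos\<close> by (simp add: ann_iff ind_fun_in_carrier cozero_set_ind_fun)
    then show ?psub
      using sub by blast
  qed
qed

section \<open>Sums of principal ideals and comaximality\<close>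

lemma mem_PIdl_sum_meas_ring_iff:
  "h \<in> PIdl\<^bsub>meas_ring M\<^esub> f <+>\<^bsub>meas_ring M\<^esub> PIdl\<^bsub>meas_ring M\<^esub> g \<longleftrightarrow>
    (\<exists>a\<in>carrier (meas_ring M). \<exists>b\<in>carrier (meas_ring M).
      h = (\<lambda>x\<in>space M. a x * f x + b x * g x))"
proof -
  have "h \<in> PIdl\<^bsub>meas_ring M\<^esub> f <+>\<^bsub>meas_ring M\<^esub> PIdl\<^bsub>meas_ring M\<^esub> g \<longleftrightarrow>
    (\<exists>a\<in>carrier (meas_ring M). \<exists>b\<in>carrier (meas_ring M).
      h = (a \<otimes>\<^bsub>meas_ring M\<^esub> f) \<oplus>\<^bsub>meas_ring M\<^esub> (b \<otimes>\<^bsub>meas_ring M\<^esub> g))"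
    unfolding set_add_def' cgenideal_def by blast
  then show ?thesis
    by (simp add: mult_meas_ring add_meas_ring cong: restrict_cong)
qed

lemma mem_PIdl_meas_ring_iff:
  "h \<in> PIdl\<^bsub>meas_ring M\<^esub> u \<longleftrightarrow> (\<exists>c\<in>carrier (meas_ring M). h = (\<lambda>x\<in>space M. c x * u x))"
  by (auto simp: cgenideal_def mult_meas_ring)

text \<open>Division by zero yields \<open>0\<close>, so \<open>f / (f\<^sup>2 + g\<^sup>2)\<close> is a total measurable function.\<close>

lemma PIdl_sum_eq_PIdl_sum_squares:
  assumes f: "f \<in> carrier (meas_ring M)" and g: "g \<in> carrier (meas_ring M)"
  shows "PIdl\<^bsub>meas_ring M\<^esub> f <+>\<^bsub>meas_ring M\<^esub> PIdl\<^bsub>meas_ring M\<^esub> g =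
    PIdl\<^bsub>meas_ring M\<^esub> (\<lambda>x\<in>space M. (f x)\<^sup>2 + (g x)\<^sup>2)" (is "_ = PIdl\<^bsub>_\<^esub> ?u")
proof -
  have [measurable]: "f \<in> borel_measurable M" "g \<in> borel_measurable M"
    using f g by (simp_all add: carrier_meas_ring_iff)
  show ?thesis
  proof (intro Set.set_eqI iffI)
    fix h assume "h \<in> PIdl\<^bsub>meas_ring M\<^esub> f <+>\<^bsub>meas_ring M\<^esub> PIdl\<^bsub>meas_ring M\<^esub> g"
    then obtain a b where ab: "a \<in> carrier (meas_ring M)" "b \<in> carrier (meas_ring M)"
      and h: "h = (\<lambda>x\<in>space M. a x * f x + b x * g x)"
      unfolding mem_PIdl_sum_meas_ring_iff by blast
    have [measurable]: "a \<in> borel_measurable M" "b \<in> borel_measurable M"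
      using ab by (simp_all add: carrier_meas_ring_iff)
    let ?c = "\<lambda>x\<in>space M. (a x * f x + b x * g x) / ((f x)\<^sup>2 + (g x)\<^sup>2)"
    have "?c \<in> carrier (meas_ring M)"
      by (intro restrict_in_carrier_meas_ring) measurable
    \<comment> \<open>Where the denominator vanishes, \<open>f x\<close> and \<open>g x\<close> are
      both \<open>0\<close>, and so is \<open>h x\<close>; elsewhere the denominator
      cancels.\<close>
    moreover have "h = (\<lambda>x\<in>space M. ?c x * ?u x)"
      by (auto simp: h fun_eq_iff sum_power2_eq_zero_iff)
    ultimately show "h \<in> PIdl\<^bsub>meas_ring M\<^esub> ?u"
      unfolding mem_PIdl_meas_ring_iff by blast
  next
    fix h assume "h \<in> PIdl\<^bsub>meas_ring M\<^esub> ?u"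
    then obtain c where c: "c \<in> carrier (meas_ring M)" and h: "h = (\<lambda>x\<in>space M. c x * ?u x)"
      unfolding mem_PIdl_meas_ring_iff by blast
    have "h = (\<lambda>x\<in>space M. (c \<otimes>\<^bsub>meas_ring M\<^esub> f) x * f x + (c \<otimes>\<^bsub>meas_ring M\<^esub> g) x * g x)"
      by (auto simp: h fun_eq_iff mult_meas_ring power2_eq_square algebra_simps)
    then show "h \<in> PIdl\<^bsub>meas_ring M\<^esub> f <+>\<^bsub>meas_ring M\<^esub> PIdl\<^bsub>meas_ring M\<^esub> g"
      unfolding mem_PIdl_sum_meas_ring_iff
      using mult_closed_meas_ring[OF c f] mult_closed_meas_ring[OF c g] by blast
  qed
qed

text \<open>Every element of the ideal sum, in particular a generator \<open>u\<close>, vanishes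
  wherever \<open>f\<close> and \<open>g\<close> both do. Conversely the sum is generated by the sum
  of squares, whose zero set is exactly the common zero set.\<close>

lemma comaximal_iff:
  assumes f: "f \<in> carrier (meas_ring M)" and g: "g \<in> carrier (meas_ring M)"
  shows "(\<exists>u. mu_unit M u \<and>
      PIdl\<^bsub>meas_ring M\<^esub> f <+>\<^bsub>meas_ring M\<^esub> PIdl\<^bsub>meas_ring M\<^esub> g = PIdl\<^bsub>meas_ring M\<^esub> u) \<longleftrightarrow>
    \<not> 0 < emeasure M (space M - cozero_set M f - cozero_set M g)" (is "?ex \<longleftrightarrow> ?null")
proof
  assume ?ex
  then obtain u where u: "u \<in> carrier (meas_ring M)" "emeasure M (zero_set M u) = 0"
    and eq: "PIdl\<^bsub>meas_ring M\<^esub> f <+>\<^bsub>meas_ring M\<^esub> PIdl\<^bsub>meas_ring M\<^esub> g = PIdl\<^bsub>meas_ring M\<^esub> u"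
    by (auto simp: mu_unit_def)
  have "u \<in> PIdl\<^bsub>meas_ring M\<^esub> u"
    using cring.axioms(1)[OF cring_meas_ring] u(1) by (rule ring.cgenideal_self)
  then obtain a b where "u = (\<lambda>x\<in>space M. a x * f x + b x * g x)"
    unfolding eq[symmetric] mem_PIdl_sum_meas_ring_iff by blast
  then have "space M - cozero_set M f - cozero_set M g \<subseteq> zero_set M u"
    by (auto simp: mem_cozero_set zero_set_def)
  moreover have "zero_set M u \<in> sets M"
    using sets_cozero_set[OF u(1)] by (simp add: zero_set_eq sets.compl_sets)
  ultimately show ?null
    using u(2) emeasure_pos_mono by (metis less_irrefl)
next
  assume ?null
  let ?u = "\<lambda>x\<in>space M. (f x)\<^sup>2 + (g x)\<^sup>2"
  have [measurable]: "f \<in> borel_measurable M" "g \<in> borel_measurable M"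
    using f g by (simp_all add: carrier_meas_ring_iff)
  have "zero_set M ?u = space M - cozero_set M f - cozero_set M g"
    by (auto simp: zero_set_def mem_cozero_set sum_power2_eq_zero_iff)
  then have "emeasure M (zero_set M ?u) = 0"
    using \<open>?null\<close> by simp
  moreover have "?u \<in> carrier (meas_ring M)"
    by (intro restrict_in_carrier_meas_ring) measurable
  ultimately have "mu_unit M ?u"
    by (simp add: mu_unit_def)
  with PIdl_sum_eq_PIdl_sum_squares[OF f g] show ?ex
    by blast
qed

section \<open>Graph equalities as conditions on cozero sets\<close>

lemma zero_divisor_graph_eq_annihilator_graph_iff:
  "zero_divisor_graph M = annihilator_graph M \<longleftrightarrow>
    (\<forall>f\<in>vertex_set M. \<forall>g\<in>vertex_set M. f \<noteq> g \<longrightarrow>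
      (\<not> 0 < emeasure M (cozero_set M f \<inter> cozero_set M g) \<longleftrightarrow>
       0 < emeasure M (cozero_set M f - cozero_set M g) \<and>
       0 < emeasure M (cozero_set M g - cozero_set M f)))"
  unfolding zero_divisor_graph_def annihilator_graph_def cozero_set_def[symmetric]
  by (subst simple_graph_eq_iff)
    (auto simp: ann_Un_psubset_iff vertex_set_carrier Int_commute zero_less_iff_neq_zero)

lemma comaximal_graph_eq_annihilator_graph_iff:
  "comaximal_graph M = annihilator_graph M \<longleftrightarrow>
    (\<forall>f\<in>vertex_set M. \<forall>g\<in>vertex_set M. f \<noteq> g \<longrightarrow>
      (\<not> 0 < emeasure M (space M - cozero_set M f - cozero_set M g) \<longleftrightarrow>
       0 < emeasure M (cozero_set M f - cozero_set M g) \<and>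
       0 < emeasure M (cozero_set M g - cozero_set M f)))"
proof -
  have swap: "space M - S - T = space M - T - S" for S T
    by blast
  show ?thesis
    unfolding comaximal_graph_def annihilator_graph_def
    by (subst simple_graph_eq_iff)
      (use swap in \<open>auto simp: ann_Un_psubset_iff comaximal_iff vertex_set_carrier\<close>)
qed

section \<open>Atoms and the two-atom case\<close>

lemma is_atom_split:
  assumes "is_atom M A" "S \<in> sets M"
  shows "0 < emeasure M (A - S) \<longleftrightarrow> \<not> 0 < emeasure M (A \<inter> S)"
proof -
  have A: "A \<in> sets M" "0 < emeasure M A"
    using assms(1) by (simp_all add: is_atom_def)
  have parts: "A - S \<in> sets M" "A \<inter> S \<in> sets M" "A = (A - S) \<union> (A \<inter> S)"
    "(A - S) \<inter> (A \<inter> S) = {}"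
    using A(1) assms(2) by auto
  then have "0 < emeasure M (A - S) \<or> 0 < emeasure M (A \<inter> S)"
    using A(2) emeasure_Un_pos_iff[OF parts(1,2)] by metis
  moreover have "\<not> (0 < emeasure M (A - S) \<and> 0 < emeasure M (A \<inter> S))"
    using assms(1) parts unfolding is_atom_def by blast
  ultimately show ?thesis
    by blast
qed

text \<open>On an atom, having positive measure behaves like a two-valued measure.\<close>

lemma is_atom_Int:
  assumes "is_atom M A" "S \<in> sets M" "T \<in> sets M"
  shows "0 < emeasure M (A \<inter> (S \<inter> T)) \<longleftrightarrow> 0 < emeasure M (A \<inter> S) \<and> 0 < emeasure M (A \<inter> T)"
proof -
  have A: "A \<in> sets M"
    using assms(1) by (simp add: is_atom_def)
  \<comment> \<open>By De Morgan the claim passes to complements in \<open>A\<close>, where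
    positivity of a union is a disjunction; \<open>is_atom_split\<close> turns it back.\<close>
  have "A - S \<inter> T = (A - S) \<union> (A - T)"
    by auto
  then have "0 < emeasure M (A - S \<inter> T) \<longleftrightarrow> 0 < emeasure M (A - S) \<or> 0 < emeasure M (A - T)"
    using A assms by (simp add: emeasure_Un_pos_iff)
  then show ?thesis
    using assms by (simp add: is_atom_split[OF assms(1)] del: not_gr_zero) argo
qed

text \<open>The difference is the intersection with a complement, and complementation negates
  positivity on an atom.\<close>

lemma is_atom_Diff:
  assumes "is_atom M A" "S \<in> sets M" "T \<in> sets M"
  shows "0 < emeasure M (A \<inter> (S - T)) \<longleftrightarrow> 0 < emeasure M (A \<inter> S) \<and> \<not> 0 < emeasure M (A \<inter> T)"
proof -
  have A: "A \<in> sets M" "A \<subseteq> space M"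
    using assms(1) sets.sets_into_space by (auto simp: is_atom_def)
  have "A \<inter> (space M - T) = A - T" "S - T = S \<inter> (space M - T)"
    using A sets.sets_into_space[OF assms(2)] by auto
  then show ?thesis
    using is_atom_Int[of M A S "space M - T"] is_atom_split[of M A T] assms by auto
qed

lemma graphs_eq_if_two_atoms:
  assumes A: "is_atom M A" and B: "is_atom M B" and cover: "space M = A \<union> B"
  shows "zero_divisor_graph M = annihilator_graph M" "comaximal_graph M = annihilator_graph M"
proof -
  have AB: "A \<in> sets M" "0 < emeasure M A" "B \<in> sets M" "0 < emeasure M B"
    using A B by (auto simp: is_atom_def)
  then have AB_space: "A \<inter> space M = A" "B \<inter> space M = B"
    by (auto simp: cover)
  have pos_iff: "0 < emeasure M S \<longleftrightarrow> 0 < emeasure M (A \<inter> S) \<or> 0 < emeasure M (B \<inter> S)"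
    if "S \<in> sets M" for S
  proof -
    have "S = (A \<inter> S) \<union> (B \<inter> S)"
      using sets.sets_into_space[OF that] cover by auto
    then show ?thesis
      using AB that emeasure_Un_pos_iff[of "A \<inter> S" M "B \<inter> S"] by auto
  qed
  \<comment> \<open>These two truth values record which atoms a measurable set charges, reducing the
    measure theory to propositional logic.\<close>
  define a b where "a S \<longleftrightarrow> 0 < emeasure M (A \<inter> S)" and "b S \<longleftrightarrow> 0 < emeasure M (B \<inter> S)" for S
  have pos_iff: "0 < emeasure M S \<longleftrightarrow> a S \<or> b S" if "S \<in> sets M" for S
    using pos_iff[OF that] by (simp add: a_def b_def)
  have atom:
    "a (S \<inter> T) \<longleftrightarrow> a S \<and> a T" "b (S \<inter> T) \<longleftrightarrow> b S \<and> b T"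
    "a (S - T) \<longleftrightarrow> a S \<and> \<not> a T" "b (S - T) \<longleftrightarrow> b S \<and> \<not> b T"
    if "S \<in> sets M" "T \<in> sets M" for S T
    unfolding a_def b_def
    by (fact is_atom_Int[OF A that] is_atom_Int[OF B that] is_atom_Diff[OF A that]
        is_atom_Diff[OF B that])+
  have space: "a (space M)" "b (space M)"
    using AB AB_space by (simp_all add: a_def b_def)
  have sets: "cozero_set M f \<in> sets M" if "f \<in> vertex_set M" for f
    using that by (intro sets_cozero_set vertex_set_carrier)
  \<comment> \<open>A vertex charges at least one atom because its cozero set is not null, and not
    both because its zero set is not null. Each adjacency of cozero sets \<open>S\<close> and
    \<open>T\<close> then says that \<open>a S\<close> and \<open>a T\<close> differ.\<close>
  have vertex: "a (cozero_set M f) \<longleftrightarrow> \<not> b (cozero_set M f)" if "f \<in> vertex_set M" for f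
    using that sets[OF that] unfolding vertex_set_iff
    by (auto simp: pos_iff atom space sets.Diff simp del: not_gr_zero)
  show "zero_divisor_graph M = annihilator_graph M"
    unfolding zero_divisor_graph_eq_annihilator_graph_iff
    by (intro ballI impI)
      (auto simp: pos_iff atom sets vertex sets.Int sets.Diff simp del: not_gr_zero)
  show "comaximal_graph M = annihilator_graph M"
    unfolding comaximal_graph_eq_annihilator_graph_iff
    by (intro ballI impI)
      (auto simp: pos_iff atom sets vertex space sets.Diff simp del: not_gr_zero)
qed

section \<open>Splitting the space and the three-part case\<close>

lemma not_is_atomE:
  assumes "\<not> is_atom M A" "A \<in> sets M" "0 < emeasure M A"
  obtains B C where "B \<in> sets M" "C \<in> sets M" "A = B \<union> C" "B \<inter> C = {}"
    "0 < emeasure M B" "0 < emeasure M C"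
  using assms unfolding is_atom_def by blast

text \<open>A non-atomic whole splits into two positive pieces. Unless both are atoms, one of them
  splits again, and the other serves as the third part.\<close>

lemma two_atoms_or_three_parts:
  assumes "0 < emeasure M (space M)" "\<not> is_atom M (space M)"
  obtains A B where "is_atom M A" "is_atom M B" "A \<inter> B = {}" "space M = A \<union> B"
  | P Q R where "P \<in> sets M" "Q \<in> sets M" "R \<in> sets M"
      "0 < emeasure M P" "0 < emeasure M Q" "0 < emeasure M R"
      "P \<inter> Q = {}" "P \<inter> R = {}" "Q \<inter> R = {}"
proof -
  obtain B C where BC: "B \<in> sets M" "C \<in> sets M" "space M = B \<union> C" "B \<inter> C = {}"
    "0 < emeasure M B" "0 < emeasure M C"
    using not_is_atomE[OF assms(2) sets.top assms(1)] by blast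
  consider "is_atom M B" "is_atom M C" | "\<not> is_atom M B" | "\<not> is_atom M C"
    by blast
  then show thesis
  proof cases
    case 1
    with BC that(1) show thesis by blast
  next
    case 2
    then obtain P Q where "P \<in> sets M" "Q \<in> sets M" "B = P \<union> Q" "P \<inter> Q = {}"
      "0 < emeasure M P" "0 < emeasure M Q"
      using not_is_atomE BC by metis
    with BC show thesis
      by (intro that(2)[of P Q C]) auto
  next
    case 3
    then obtain P Q where "P \<in> sets M" "Q \<in> sets M" "C = P \<union> Q" "P \<inter> Q = {}"
      "0 < emeasure M P" "0 < emeasure M Q"
      using not_is_atomE BC by metis
    with BC show thesis
      by (intro that(2)[of P Q B]) auto
  qed
qed

text \<open>\<open>T\<close> witnesses that the indicator of \<open>S\<close> has a zero set of
  positive measure.\<close>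

lemma ind_fun_in_vertex_set:
  assumes "S \<in> sets M" "T \<in> sets M" "S \<inter> T = {}" "0 < emeasure M S" "0 < emeasure M T"
  shows "ind_fun M S \<in> vertex_set M"
proof -
  have "0 < emeasure M (space M - S)"
    by (rule emeasure_pos_mono[of T]) (use assms sets.sets_into_space[of T M] in auto)
  then show ?thesis
    using assms by (simp add: vertex_set_iff ind_fun_in_carrier cozero_set_ind_fun)
qed

lemma graphs_neq_if_three_parts:
  assumes sets: "P \<in> sets M" "Q \<in> sets M" "R \<in> sets M"
    and pos: "0 < emeasure M P" "0 < emeasure M Q" "0 < emeasure M R"
    and disj: "P \<inter> Q = {}" "P \<inter> R = {}" "Q \<inter> R = {}"
  shows "zero_divisor_graph M \<noteq> annihilator_graph M" "comaximal_graph M \<noteq> annihilator_graph M"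
proof -
  \<comment> \<open>The criteria for graph equality concern distinct vertices only, so the
    counterexamples must be shown to be distinct functions.\<close>
  have neq: "ind_fun M S \<noteq> ind_fun M T"
    if "S \<in> sets M" "T \<in> sets M" "0 < emeasure M (S - T)" for S T
  proof
    assume "ind_fun M S = ind_fun M T"
    then have "S = T"
      using that cozero_set_ind_fun by metis
    with that(3) show False
      by simp
  qed
  \<comment> \<open>The overlap \<open>Q\<close> rules out a zero-divisor edge, while the
    differences \<open>P\<close> and \<open>R\<close> give an annihilator edge.\<close>
  let ?S = "P \<union> Q" and ?T = "Q \<union> R"
  have ST: "?S - ?T = P" "?T - ?S = R" "?S \<inter> ?T = Q" "?S \<inter> R = {}" "?T \<inter> P = {}"
    using disj by auto
  have "ind_fun M ?S \<in> vertex_set M"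
    using sets pos ST by (intro ind_fun_in_vertex_set[of _ _ R]) (auto simp: emeasure_Un_pos_iff)
  moreover have "ind_fun M ?T \<in> vertex_set M"
    using sets pos ST by (intro ind_fun_in_vertex_set[of _ _ P]) (auto simp: emeasure_Un_pos_iff)
  moreover have "ind_fun M ?S \<noteq> ind_fun M ?T"
    using sets pos ST by (intro neq) auto
  moreover have "cozero_set M (ind_fun M ?S) = ?S" "cozero_set M (ind_fun M ?T) = ?T"
    using sets by (auto intro!: cozero_set_ind_fun)
  ultimately show "zero_divisor_graph M \<noteq> annihilator_graph M"
    unfolding zero_divisor_graph_eq_annihilator_graph_iff using pos ST by metis
  have PQ: "P - Q = P" "Q - P = Q"
    using disj by auto
  \<comment> \<open>The indicators of \<open>P\<close> and \<open>Q\<close> both vanish on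
    \<open>R\<close>, which rules out a comaximal edge.\<close>
  have "0 < emeasure M (space M - P - Q)"
    by (rule emeasure_pos_mono[of R])
      (use sets.sets_into_space[OF sets(3)] sets pos disj in auto)
  moreover have "ind_fun M P \<in> vertex_set M"
    using sets pos disj by (intro ind_fun_in_vertex_set[of _ _ Q]) auto
  moreover have "ind_fun M Q \<in> vertex_set M"
    using sets pos disj by (intro ind_fun_in_vertex_set[of _ _ P]) auto
  moreover have "ind_fun M P \<noteq> ind_fun M Q"
    using sets pos PQ by (intro neq) auto
  moreover have "cozero_set M (ind_fun M P) = P" "cozero_set M (ind_fun M Q) = Q"
    using sets by (auto intro!: cozero_set_ind_fun)
  ultimately show "comaximal_graph M \<noteq> annihilator_graph M"
    unfolding comaximal_graph_eq_annihilator_graph_iff using pos PQ by metis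
qed

theorem theorem4p10:
  fixes M :: "'a measure"
  assumes "emeasure M (space M) > 0"
    and "\<not> is_atom M (space M)"
  shows "(zero_divisor_graph M = annihilator_graph M \<longleftrightarrow> comaximal_graph M = annihilator_graph M)
    \<and> (comaximal_graph M = annihilator_graph M \<longleftrightarrow>
        (\<exists>A B. is_atom M A \<and> is_atom M B \<and> A \<inter> B = {} \<and> space M = A \<union> B))"
  using two_atoms_or_three_parts[OF assms]
proof cases
  case (1 A B)
  then show ?thesis
    using graphs_eq_if_two_atoms[of M A B] by blast
next
  case (2 P Q R)
  have "zero_divisor_graph M \<noteq> annihilator_graph M" "comaximal_graph M \<noteq> annihilator_graph M"
    using graphs_neq_if_three_parts[OF 2] by blast+
  \<comment> \<open>All three statements fail: a partition into two atoms would force the graph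
    equality just refuted.\<close>
  then show ?thesis
    using graphs_eq_if_two_atoms(2)[of M] by blast
qed

end
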